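(* Let $m\ge 2$ be an integer and let $(a_{i1},a_{i2})\in\mathbb{R}^2$, $i\in\{1,\ldots,m\}$, be points forming a path in $\mathbb{R}^2$, with consecutive points distinct. For $i\in\{1,\ldots,m-1\}$ let $$\delta_i:=\sqrt{(a_{i+1,1}-a_{i,1})^2+(a_{i+1,2}-a_{i,2})^2},$$ and let $t_1:=0$ and $t_i:=\delta_1+\cdots+\delta_{i-1}$ for $i\in\{2,\ldots,m\}$. Let $F$ be the set of points $(x_1,\ldots,x_m)\in\mathbb{R}^m$ such that $$\frac{x_{i+1}-x_i}{t_{i+1}-t_i}=\frac{x_{i+2}-x_{i+1}}{t_{i+2}-t_{i+1}}\quad\text{for all } i\in\{1,\ldots,m-2\}.$$ Let $z=(z_1,\ldots,z_m)\in\mathbb{R}^m$. Then the projection $P_F z\in\mathbb{R}^m$ is given by $$(P_F z)_i=f(t_i)=\alpha+\beta t_i\quad\text{for all } i\in\{1,\ldots,m\},$$ where $f(t)=\alpha+\beta t$ is the least squares line for the points $(t_i,z_i)\in\mathbb{R}^2$, $i\in\{1,\ldots,m\}$.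
   Context: $\mathbb{R}^m$ carries the standard inner product and the induced Euclidean norm $\|\cdot\|$. For a nonempty closed convex set $C\subseteq\mathbb{R}^m$, $P_C z$ denotes the unique point of $C$ minimizing $\|z-x\|$ over $x\in C$. The least squares line for points $(t_i,z_i)$, $i\in\{1,\ldots,m\}$, is the affine function $f(t)=\alpha+\beta t$ whose coefficients $(\alpha,\beta)\in\mathbb{R}^2$ minimize $\sum_{i=1}^m(\alpha+\beta t_i-z_i)^2$. *)

theory Defs
  imports "HOL-Analysis.Analysis"
begin

definition path_delta :: "(nat \<Rightarrow> real ^ 2) \<Rightarrow> nat \<Rightarrow> real" where
  "path_delta a i = sqrt ((a (i + 1) $ 1 - a i $ 1)\<^sup>2 + (a (i + 1) $ 2 - a i $ 2)\<^sup>2)"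

(* The sum is over the indices 1, ..., i - 1; in particular it is empty, hence 0, for i = 1. *)
definition path_t :: "(nat \<Rightarrow> real ^ 2) \<Rightarrow> nat \<Rightarrow> real" where
  "path_t a i = (\<Sum>j = 1..<i. path_delta a j)"

(* Euclidean m-space is rendered as real ^ 'n for an arbitrary finite index type 'n with m
   elements.  Such a type carries no order, so e enumerates it as e 1, ..., e m (in the
   application e is a bijection from {1..m} onto the type): the i-th coordinate of x is x $ e i. *)
definition equal_slopes_set ::
  "nat \<Rightarrow> (nat \<Rightarrow> 'n::finite) \<Rightarrow> (nat \<Rightarrow> real) \<Rightarrow> (real ^ 'n) set" where
  "equal_slopes_set m e t =
     {x. \<forall>i\<in>{1..m - 2}.
           (x $ e (i + 1) - x $ e i) / (t (i + 1) - t i) =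
           (x $ e (i + 2) - x $ e (i + 1)) / (t (i + 2) - t (i + 1))}"

definition is_least_squares :: "nat \<Rightarrow> (nat \<Rightarrow> real) \<Rightarrow> (nat \<Rightarrow> real) \<Rightarrow> real \<times> real \<Rightarrow> bool" where
  "is_least_squares m t z =
     is_arg_min (\<lambda>(\<alpha>, \<beta>). \<Sum>i = 1..m. (\<alpha> + \<beta> * t i - z i)\<^sup>2) (\<lambda>_. True)"

(* Definite description: meaningful only when the minimizing pair exists and is unique. *)
definition least_squares_coeffs :: "nat \<Rightarrow> (nat \<Rightarrow> real) \<Rightarrow> (nat \<Rightarrow> real) \<Rightarrow> real \<times> real" where
  "least_squares_coeffs m t z = (THE c. is_least_squares m t z c)"

end

theory Submission
  imports Defs
begin

text \<open>
  When consecutive nodes are distinct, a vector has equal consecutive slopes exactly if its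
  coordinates are the values \<open>p + q * t i\<close> of an affine function
  (\<open>mem_equal_slopes_set_iff\<close>). For such a vector, the sum of squares minimized by the least
  squares line is its squared distance to \<open>z\<close> (\<open>dist_square_eq_sum\<close>). Hence \<open>(p, q)\<close> is a pair of
  least squares coefficients exactly if the vector of values of the affine function is a nearest
  point to \<open>z\<close> in the subspace \<open>equal_slopes_set m e t\<close>. A subspace of a Euclidean space is
  closed and convex, so that there is one and only one nearest point; two distinct nodes determine
  the coefficients from the values, and therefore the least squares line exists and is unique
  as well. The nodes given by the arc length along a path have distinct consecutive values because
  consecutive points of the path are distinct.
\<close>

lemma path_t_Suc_neq:
  assumes "1 \<le> i" and "a i \<noteq> a (i + 1)"
  shows "path_t a (i + 1) \<noteq> path_t a i"
proof -
  have "path_delta a i \<noteq> 0"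
  proof
    assume "path_delta a i = 0"
    then have "a (i + 1) $ 1 = a i $ 1 \<and> a (i + 1) $ 2 = a i $ 2"
      by (simp add: path_delta_def sum_power2_eq_zero_iff)
    then have "a i = a (i + 1)"
      by (simp add: vec_eq_iff forall_2)
    with assms(2) show False by simp
  qed
  with assms(1) show ?thesis
    by (simp add: path_t_def)
qed

lemma subspace_equal_slopes_set: "subspace (equal_slopes_set m e t)"
proof (rule subspaceI)
  show "0 \<in> equal_slopes_set m e t"
    by (simp add: equal_slopes_set_def)
next
  fix x y assume x: "x \<in> equal_slopes_set m e t" and y: "y \<in> equal_slopes_set m e t"
  have split: "((x + y) $ j - (x + y) $ k) / d = (x $ j - x $ k) / d + (y $ j - y $ k) / d"
    for j k d by (simp add: add_divide_distrib diff_divide_distrib)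
  show "x + y \<in> equal_slopes_set m e t"
    using x y unfolding equal_slopes_set_def mem_Collect_eq split by simp
next
  fix c x assume x: "x \<in> equal_slopes_set m e t"
  have scale: "((c *\<^sub>R x) $ j - (c *\<^sub>R x) $ k) / d = c * ((x $ j - x $ k) / d)" for j k d
    by (simp add: right_diff_distrib)
  show "c *\<^sub>R x \<in> equal_slopes_set m e t"
    using x unfolding equal_slopes_set_def mem_Collect_eq scale by simp
qed

lemma mem_equal_slopes_set_iff:
  assumes t: "\<forall>i\<in>{1..m - 1}. t (i + 1) \<noteq> t i"
  shows "x \<in> equal_slopes_set m e t \<longleftrightarrow> (\<exists>p q. \<forall>i\<in>{1..m}. x $ e i = p + q * t i)"
proof
  assume x: "x \<in> equal_slopes_set m e t"
  define q where "q = (x $ e 2 - x $ e 1) / (t 2 - t 1)"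
  have slope: "1 \<le> i \<Longrightarrow> i \<le> m - 1 \<Longrightarrow> (x $ e (i + 1) - x $ e i) / (t (i + 1) - t i) = q" for i
  proof (induction i rule: nat_induct_at_least)
    case base
    show ?case by (simp add: q_def numeral_2_eq_2)
  next
    case (Suc i)
    from Suc.hyps Suc.prems have "i \<in> {1..m - 2}" by auto
    with x have "(x $ e (i + 1) - x $ e i) / (t (i + 1) - t i) =
        (x $ e (i + 2) - x $ e (i + 1)) / (t (i + 2) - t (i + 1))"
      by (auto simp: equal_slopes_set_def)
    with Suc show ?case by simp
  qed
  have "1 \<le> i \<Longrightarrow> i \<le> m \<Longrightarrow> x $ e i = (x $ e 1 - q * t 1) + q * t i" for i
  proof (induction i rule: nat_induct_at_least)
    case base
    show ?case by simp
  next
    case (Suc i)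
    from Suc.hyps Suc.prems have i: "i \<in> {1..m - 1}" by auto
    with t have "t (i + 1) - t i \<noteq> 0" by simp
    with slope[of i] i have "x $ e (i + 1) - x $ e i = q * (t (i + 1) - t i)"
      by (simp add: field_simps)
    with Suc show ?case by (simp add: algebra_simps)
  qed
  then show "\<exists>p q. \<forall>i\<in>{1..m}. x $ e i = p + q * t i"
    by (meson atLeastAtMost_iff)
next
  assume "\<exists>p q. \<forall>i\<in>{1..m}. x $ e i = p + q * t i"
  then obtain p q where x: "\<And>i. i \<in> {1..m} \<Longrightarrow> x $ e i = p + q * t i" by blast
  have "(x $ e (i + 1) - x $ e i) / (t (i + 1) - t i) = q" if "i \<in> {1..m - 1}" for i
  proof -
    have "x $ e (i + 1) - x $ e i = q * (t (i + 1) - t i)"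
      using that x[of i] x[of "i + 1"] by (auto simp: algebra_simps)
    then show ?thesis using t that by simp
  qed
  from this[of i for i] this[of "i + 1" for i]
  show "x \<in> equal_slopes_set m e t"
    by (auto simp: equal_slopes_set_def)
qed

lemma dist_square_eq_sum:
  fixes x z :: "real ^ 'n"
  assumes "bij_betw e {1..m} (UNIV :: 'n set)"
    and "\<forall>i\<in>{1..m}. x $ e i = p + q * t i"
  shows "(dist z x)\<^sup>2 = (\<Sum>i = 1..m. (p + q * t i - z $ e i)\<^sup>2)"
proof -
  have "(dist z x)\<^sup>2 = (\<Sum>j\<in>UNIV. (x $ j - z $ j)\<^sup>2)"
    unfolding dist_commute[of z x] by (simp add: dist_vec_def L2_set_def sum_nonneg dist_real_def)
  also have "\<dots> = (\<Sum>i = 1..m. (x $ e i - z $ e i)\<^sup>2)"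
    using sum.reindex_bij_betw[OF assms(1), of "\<lambda>j. (x $ j - z $ j)\<^sup>2"] by simp
  also have "\<dots> = (\<Sum>i = 1..m. (p + q * t i - z $ e i)\<^sup>2)"
    using assms(2) by simp
  finally show ?thesis .
qed

lemma is_least_squares_iff_closest_point:
  fixes x z :: "real ^ 'n"
  assumes e: "bij_betw e {1..m} (UNIV :: 'n set)"
    and t: "\<forall>i\<in>{1..m - 1}. t (i + 1) \<noteq> t i"
    and x: "\<forall>i\<in>{1..m}. x $ e i = p + q * t i"
  shows "is_least_squares m t (\<lambda>i. z $ e i) (p, q) \<longleftrightarrow>
    x = closest_point (equal_slopes_set m e t) z"
proof -
  let ?F = "equal_slopes_set m e t"
  let ?S = "\<lambda>p q. \<Sum>i = 1..m. (p + q * t i - z $ e i)\<^sup>2"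
  have F: "closed ?F" "convex ?F"
    by (simp_all add: subspace_equal_slopes_set closed_subspace subspace_imp_convex)
  have xF: "x \<in> ?F"
    using x mem_equal_slopes_set_iff[OF t] by blast
  have realize: "\<exists>y. \<forall>i\<in>{1..m}. y $ e i = p' + q' * t i" for p' q'
  proof
    show "\<forall>i\<in>{1..m}. (\<chi> j. p' + q' * t (inv_into {1..m} e j)) $ e i = p' + q' * t i"
      using bij_betw_inv_into_left[OF e] by simp
  qed
  have "is_least_squares m t (\<lambda>i. z $ e i) (p, q) \<longleftrightarrow> (\<forall>p' q'. ?S p q \<le> ?S p' q')"
    by (simp add: is_least_squares_def is_arg_min_linorder)
  also have "\<dots> \<longleftrightarrow> (\<forall>y\<in>?F. (dist z x)\<^sup>2 \<le> (dist z y)\<^sup>2)"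
  proof
    assume *: "\<forall>p' q'. ?S p q \<le> ?S p' q'"
    show "\<forall>y\<in>?F. (dist z x)\<^sup>2 \<le> (dist z y)\<^sup>2"
    proof
      fix y assume "y \<in> ?F"
      then obtain p' q' where y: "\<forall>i\<in>{1..m}. y $ e i = p' + q' * t i"
        using mem_equal_slopes_set_iff[OF t] by blast
      from * show "(dist z x)\<^sup>2 \<le> (dist z y)\<^sup>2"
        unfolding dist_square_eq_sum[OF e x] dist_square_eq_sum[OF e y] by blast
    qed
  next
    assume *: "\<forall>y\<in>?F. (dist z x)\<^sup>2 \<le> (dist z y)\<^sup>2"
    show "\<forall>p' q'. ?S p q \<le> ?S p' q'"
    proof (intro allI)
      fix p' q'
      obtain y where y: "\<forall>i\<in>{1..m}. y $ e i = p' + q' * t i"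
        using realize by blast
      then have "y \<in> ?F"
        using mem_equal_slopes_set_iff[OF t] by blast
      with * show "?S p q \<le> ?S p' q'"
        unfolding dist_square_eq_sum[OF e x, symmetric] dist_square_eq_sum[OF e y, symmetric]
        by blast
    qed
  qed
  also have "\<dots> \<longleftrightarrow> (\<forall>y\<in>?F. dist z x \<le> dist z y)"
    by simp
  also have "\<dots> \<longleftrightarrow> x = closest_point ?F z"
    using closest_point_unique[OF F(2,1) xF] closest_point_le[OF F(1)] by blast
  finally show ?thesis .
qed

lemma closest_point_equal_slopes_set:
  fixes z :: "real ^ 'n"
  assumes m: "m \<ge> 2"
    and e: "bij_betw e {1..m} (UNIV :: 'n set)"
    and t: "\<forall>i\<in>{1..m - 1}. t (i + 1) \<noteq> t i"
    and c: "(\<alpha>, \<beta>) = least_squares_coeffs m t (\<lambda>i. z $ e i)"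
  shows "\<forall>i\<in>{1..m}. closest_point (equal_slopes_set m e t) z $ e i = \<alpha> + \<beta> * t i"
proof -
  let ?F = "equal_slopes_set m e t"
  let ?x = "closest_point ?F z"
  have "?x \<in> ?F"
    using closest_point_in_set[OF closed_subspace] subspace_0 subspace_equal_slopes_set
    by (metis empty_iff)
  then obtain p q where x: "\<forall>i\<in>{1..m}. ?x $ e i = p + q * t i"
    using mem_equal_slopes_set_iff[OF t] by blast
  have "least_squares_coeffs m t (\<lambda>i. z $ e i) = (p, q)"
    unfolding least_squares_coeffs_def
  proof (rule the_equality)
    show "is_least_squares m t (\<lambda>i. z $ e i) (p, q)"
      using is_least_squares_iff_closest_point[OF e t x] by simp
  next
    fix c' assume c': "is_least_squares m t (\<lambda>i. z $ e i) c'"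
    obtain p' q' where pq': "c' = (p', q')" by (cases c')
    define y :: "real ^ 'n" where "y = (\<chi> j. p' + q' * t (inv_into {1..m} e j))"
    have y: "\<forall>i\<in>{1..m}. y $ e i = p' + q' * t i"
      using bij_betw_inv_into_left[OF e] by (simp add: y_def)
    have "y = ?x"
      using is_least_squares_iff_closest_point[OF e t y] c' pq' by simp
    with x y have eq: "p' + q' * t i = p + q * t i" if "i \<in> {1..m}" for i
      using that by simp
    \<comment> \<open>Two affine functions that agree at the distinct nodes \<open>t 1\<close> and \<open>t 2\<close> are equal.\<close>
    have "p' + q' * t 1 = p + q * t 1" "p' + q' * t 2 = p + q * t 2"
      using m by (simp_all add: eq)
    moreover from this have "(q' - q) * (t 2 - t 1) = 0"
      by (simp add: algebra_simps)
    moreover have "t 2 \<noteq> t 1"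
      using t[rule_format, of 1] m by (simp add: numeral_2_eq_2)
    ultimately show "c' = (p, q)"
      by (simp add: pq')
  qed
  with c x show ?thesis by simp
qed

theorem theorem3p4:
  fixes m :: nat and e :: "nat \<Rightarrow> 'n::finite"
    and a :: "nat \<Rightarrow> real ^ 2" and z :: "real ^ 'n"
    and \<alpha> \<beta> :: real and f :: "real \<Rightarrow> real"
  assumes "m \<ge> 2"
    and "bij_betw e {1..m} (UNIV :: 'n set)"
    and "\<forall>i\<in>{1..m - 1}. a i \<noteq> a (i + 1)"
    and "(\<alpha>, \<beta>) = least_squares_coeffs m (path_t a) (\<lambda>i. z $ e i)"
    and "\<forall>s. f s = \<alpha> + \<beta> * s"
  shows "\<forall>i\<in>{1..m}.
    closest_point (equal_slopes_set m e (path_t a)) z $ e i = f (path_t a i) \<and>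
    f (path_t a i) = \<alpha> + \<beta> * path_t a i"
proof -
  have "\<forall>i\<in>{1..m - 1}. path_t a (i + 1) \<noteq> path_t a i"
    using assms(3) path_t_Suc_neq by simp
  from closest_point_equal_slopes_set[OF assms(1,2) this assms(4)] assms(5)
  show ?thesis by simp
qed

end
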